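(* For every choice of the category $\mathbf{GMet}$ (i.e. every set $\mathcal H$ of Horn implications as in the context), every $\Phi\subseteq\mathrm{GEq}$ and every $\phi\in\mathrm{GEq}$: if $\Phi\vdash\phi$ then $\Phi\Vvdash\phi$.
   Context: Fix a signature $\Sigma$: a set of operation symbols $op$, each with a finite arity $ar(op)\in\mathbb N$. For a set $A$, $\mathrm{Terms}_\Sigma(A)$ is the set of $\Sigma$-terms built from elements of $A$ (elements of $A$ are terms; if $t_1,\dots,t_n$ are terms and $ar(op)=n$ then $op(t_1,\dots,t_n)$ is a term). A fuzzy relation space is a pair $(A,d_A)$ with $A$ a set and $d_A:A\times A\to[0,1]$; a map $f:(A,d_A)\to(B,d_B)$ is nonexpansive if $d_B(f(a),f(a'))\le d_A(a,a')$ for all $a,a'\in A$. Fix a set $\mathcal H$ of Horn implications $\forall\vec x.(F_1\wedge\dots\wedge F_n\Rightarrow G)$ whose atomic formulas have the form $x=y$ or $d(x,y)\le\epsilon$ ($\epsilon\in[0,1]$); $\mathbf{GMet}$ is the full subcategory of the category of fuzzy relation spaces and nonexpansive maps whose objects ($\mathbf{GMet}$ spaces) satisfy all implications in $\mathcal H$. A quantitative algebra is a triple $\mathbb A=(A,d_A,\{op^{\mathbb A}\}_{op\in\Sigma})$ with $(A,d_A)$ a $\mathbf{GMet}$ space and each $op^{\mathbb A}:A^{ar(op)}\to A$ an arbitrary function (not required to be nonexpansive). An interpretation of a $\mathbf{GMet}$ space $(X,d_X)$ in $\mathbb A$ is a nonexpansive map $\tau:(X,d_X)\to(A,d_A)$;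 it extends to $[\![\cdot]\!]^{\mathbb A}_\tau:\mathrm{Terms}_\Sigma(X)\to A$ by $[\![x]\!]^{\mathbb A}_\tau=\tau(x)$ and $[\![op(t_1,\dots,t_n)]\!]^{\mathbb A}_\tau=op^{\mathbb A}([\![t_1]\!]^{\mathbb A}_\tau,\dots,[\![t_n]\!]^{\mathbb A}_\tau)$. A $\mathbf{GMet}$ equation is a formal expression $\forall(X,d_X).\,s=t$ and a $\mathbf{GMet}$ quantitative equation is $\forall(X,d_X).\,s=_\epsilon t$, where $(X,d_X)$ is a $\mathbf{GMet}$ space, $s,t\in\mathrm{Terms}_\Sigma(X)$ and $\epsilon\in[0,1]$; $\mathrm{GEq}$ is the set of all of these. $\mathbb A\models\forall(X,d_X).s=t$ iff $[\![s]\!]^{\mathbb A}_\tau=[\![t]\!]^{\mathbb A}_\tau$ for every nonexpansive $\tau:(X,d_X)\to(A,d_A)$; $\mathbb A\models\forall(X,d_X).s=_\epsilon t$ iff $d_A([\![s]\!]^{\mathbb A}_\tau,[\![t]\!]^{\mathbb A}_\tau)\le\epsilon$ for every such $\tau$. For $\Phi\subseteq\mathrm{GEq}$ and $\phi\in\mathrm{GEq}$, $\Phi\Vvdash\phi$ means that every quantitative algebra satisfying all elements of $\Phi$ satisfies $\phi$. The relation $\vdash\subseteq\mathcal P(\mathrm{GEq})\times\mathrm{GEq}$ is the smallest relation such that: (INIT) $\Phi\vdash\phi$ whenever $\phi\in\Phi$; (CUT) if $\Phi\vdash\phi$ for all $\phi\in\Phi'$ and $\Phi\cup\Phi'\vdash\psi$,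 then $\Phi\vdash\psi$; (WEAKENING) if $\Phi\vdash\phi$ then $\Phi\cup\Phi'\vdash\phi$; and it contains all instances of the following schemes, for every $\mathbf{GMet}$ space $(A,d_A)$, terms $s,t,u,s_i,t_i\in\mathrm{Terms}_\Sigma(A)$ and $\epsilon,\delta\in[0,1]$: (a) $\emptyset\vdash\forall(A,d_A).s=s$; (b) $\{\forall(A,d_A).s=t\}\vdash\forall(A,d_A).t=s$; (c) $\{\forall(A,d_A).s=t,\forall(A,d_A).t=u\}\vdash\forall(A,d_A).s=u$; (d) for $op$ of arity $n$, $\{\forall(A,d_A).s_i=t_i\}_{i=1}^n\vdash\forall(A,d_A).op(s_1,\dots,s_n)=op(t_1,\dots,t_n)$; (e) for $\mathbf{GMet}$ spaces $(A,d_A),(B,d_B)$ and any map $\sigma:A\to\mathrm{Terms}_\Sigma(B)$ (extended homomorphically to terms), with $\Psi=\{\forall(B,d_B).\sigma(a)=_{d_A(a,a')}\sigma(a')\mid a,a'\in A\}$: $\Psi\cup\{\forall(A,d_A).s=t\}\vdash\forall(B,d_B).\sigma(s)=\sigma(t)$ and $\Psi\cup\{\forall(A,d_A).s=_\epsilon t\}\vdash\forall(B,d_B).\sigma(s)=_\epsilon\sigma(t)$; (f) for $a,a'\in A$, $\emptyset\vdash\forall(A,d_A).a=_{d_A(a,a')}a'$; (g) for $\epsilon\le\delta$, $\{\forall(A,d_A).s=_\epsilon t\}\vdash\forall(A,d_A).s=_\delta t$; (h) $\emptyset\vdash\forall(A,d_A).s=_1t$; (i) for any index set $I$ and $\epsilon_i\in[0,1]$,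 $\{\forall(A,d_A).s=_{\epsilon_i}t\}_{i\in I}\vdash\forall(A,d_A).s=_{\inf_i\epsilon_i}t$; (j) $\{\forall(A,d_A).s=t,\forall(A,d_A).t=_\epsilon u\}\vdash\forall(A,d_A).s=_\epsilon u$ and $\{\forall(A,d_A).s=t,\forall(A,d_A).u=_\epsilon s\}\vdash\forall(A,d_A).u=_\epsilon t$; (k) for each implication $\forall X.(F_1\wedge\dots\wedge F_n\Rightarrow G)$ in $\mathcal H$ and each map $\sigma:X\to\mathrm{Terms}_\Sigma(A)$, $\{\phi_{F_1},\dots,\phi_{F_n}\}\vdash\phi_G$, where $\phi_F$ is $\forall(A,d_A).\sigma(x)=\sigma(y)$ if $F$ is $x=y$, and $\forall(A,d_A).\sigma(x)=_\epsilon\sigma(y)$ if $F$ is $d(x,y)\le\epsilon$. *)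

theory Defs
  imports Complex_Main "HOL-Library.FuncSet"
begin

text \<open>A signature is a partial map from operation symbols to arities: its domain is the set of
  operation symbols (possibly empty).\<close>

type_synonym 'f signature = "'f \<Rightarrow> nat option"

datatype ('f, 'a) tm = Var 'a | Op 'f "('f, 'a) tm list"

inductive_set Terms :: "'f signature \<Rightarrow> 'a set \<Rightarrow> ('f, 'a) tm set"
  for Sig :: "'f signature" and A :: "'a set"
where
  "a \<in> A \<Longrightarrow> Var a \<in> Terms Sig A"
| "Sig f = Some (length ts) \<Longrightarrow> (\<And>t. t \<in> set ts \<Longrightarrow> t \<in> Terms Sig A) \<Longrightarrow> Op f ts \<in> Terms Sig A"

primrec subst :: "('a \<Rightarrow> ('f, 'b) tm) \<Rightarrow> ('f, 'a) tm \<Rightarrow> ('f, 'b) tm" where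
  "subst \<sigma> (Var a) = \<sigma> a"
| "subst \<sigma> (Op f ts) = Op f (map (subst \<sigma>) ts)"

record 'a frspace =
  pts :: "'a set"
  fdist :: "'a \<times> 'a \<Rightarrow> real"

text \<open>The extensional function space makes two spaces equal as HOL objects exactly when they have
  the same points and the same fuzzy relation on them.\<close>

definition fuzzy_space :: "('a, 'z) frspace_scheme \<Rightarrow> bool" where
  "fuzzy_space X \<longleftrightarrow> fdist X \<in> pts X \<times> pts X \<rightarrow>\<^sub>E {0..1}"

definition nonexpansive ::
  "('a, 'y) frspace_scheme \<Rightarrow> ('b, 'z) frspace_scheme \<Rightarrow> ('a \<Rightarrow> 'b) \<Rightarrow> bool" where
  "nonexpansive X Y f \<longleftrightarrow>
     f \<in> pts X \<rightarrow> pts Y \<and>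
     (\<forall>a\<in>pts X. \<forall>a'\<in>pts X. fdist Y (f a, f a') \<le> fdist X (a, a'))"

datatype 'v atom = AEq 'v 'v | ADist 'v 'v real

text \<open>\<open>Horn xs Fs G\<close> is the implication with quantified variables \<open>xs\<close>, premises \<open>Fs\<close> and
  conclusion \<open>G\<close>.\<close>

datatype 'v horn = Horn "'v list" "'v atom list" "'v atom"

primrec wf_atom :: "'v set \<Rightarrow> 'v atom \<Rightarrow> bool" where
  "wf_atom V (AEq x y) \<longleftrightarrow> x \<in> V \<and> y \<in> V"
| "wf_atom V (ADist x y \<epsilon>) \<longleftrightarrow> x \<in> V \<and> y \<in> V \<and> \<epsilon> \<in> {0..1}"

primrec wf_horn :: "'v horn \<Rightarrow> bool" where
  "wf_horn (Horn xs Fs G) \<longleftrightarrow> (\<forall>F\<in>set Fs. wf_atom (set xs) F) \<and> wf_atom (set xs) G"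

primrec atom_holds :: "('a, 'z) frspace_scheme \<Rightarrow> ('v \<Rightarrow> 'a) \<Rightarrow> 'v atom \<Rightarrow> bool" where
  "atom_holds X \<rho> (AEq x y) \<longleftrightarrow> \<rho> x = \<rho> y"
| "atom_holds X \<rho> (ADist x y \<epsilon>) \<longleftrightarrow> fdist X (\<rho> x, \<rho> y) \<le> \<epsilon>"

primrec horn_holds :: "('a, 'z) frspace_scheme \<Rightarrow> 'v horn \<Rightarrow> bool" where
  "horn_holds X (Horn xs Fs G) \<longleftrightarrow>
     (\<forall>\<rho> \<in> set xs \<rightarrow> pts X. (\<forall>F\<in>set Fs. atom_holds X \<rho> F) \<longrightarrow> atom_holds X \<rho> G)"

definition gmet_space :: "'v horn set \<Rightarrow> ('a, 'z) frspace_scheme \<Rightarrow> bool" where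
  "gmet_space H X \<longleftrightarrow> fuzzy_space X \<and> (\<forall>h\<in>H. horn_holds X h)"

record ('f, 'a) qalgebra = "'a frspace" +
  opr :: "'f \<Rightarrow> 'a list \<Rightarrow> 'a"

definition quantitative_algebra ::
  "'f signature \<Rightarrow> 'v horn set \<Rightarrow> ('f, 'a) qalgebra \<Rightarrow> bool" where
  "quantitative_algebra Sig H \<A> \<longleftrightarrow>
     gmet_space H \<A> \<and>
     (\<forall>f n. Sig f = Some n \<longrightarrow>
        (\<forall>as. length as = n \<and> set as \<subseteq> pts \<A> \<longrightarrow> opr \<A> f as \<in> pts \<A>))"

primrec tm_eval :: "('f, 'b) qalgebra \<Rightarrow> ('a \<Rightarrow> 'b) \<Rightarrow> ('f, 'a) tm \<Rightarrow> 'b" where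
  "tm_eval \<A> \<tau> (Var x) = \<tau> x"
| "tm_eval \<A> \<tau> (Op f ts) = opr \<A> f (map (tm_eval \<A> \<tau>) ts)"

text \<open>\<open>Eqn X s t\<close> is the equation of \<open>s\<close> and \<open>t\<close> over the space \<open>X\<close>, and \<open>QEqn X s \<epsilon> t\<close> the
  quantitative equation bounding their distance by \<open>\<epsilon>\<close>. The spaces range over subsets of an
  arbitrary type \<open>'a\<close>, which plays the role of the universe of sets.\<close>

datatype ('f, 'a) gequation =
    Eqn "'a frspace" "('f, 'a) tm" "('f, 'a) tm"
  | QEqn "'a frspace" "('f, 'a) tm" real "('f, 'a) tm"

primrec wf_gequation :: "'f signature \<Rightarrow> 'v horn set \<Rightarrow> ('f, 'a) gequation \<Rightarrow> bool" where
  "wf_gequation Sig H (Eqn X s t) \<longleftrightarrow>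
     gmet_space H X \<and> s \<in> Terms Sig (pts X) \<and> t \<in> Terms Sig (pts X)"
| "wf_gequation Sig H (QEqn X s \<epsilon> t) \<longleftrightarrow>
     gmet_space H X \<and> s \<in> Terms Sig (pts X) \<and> t \<in> Terms Sig (pts X) \<and> \<epsilon> \<in> {0..1}"

definition GEq :: "'f signature \<Rightarrow> 'v horn set \<Rightarrow> ('f, 'a) gequation set" where
  "GEq Sig H = {\<phi>. wf_gequation Sig H \<phi>}"

primrec sat :: "('f, 'b) qalgebra \<Rightarrow> ('f, 'a) gequation \<Rightarrow> bool" where
  "sat \<A> (Eqn X s t) \<longleftrightarrow>
     (\<forall>\<tau>. nonexpansive X \<A> \<tau> \<longrightarrow> tm_eval \<A> \<tau> s = tm_eval \<A> \<tau> t)"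
| "sat \<A> (QEqn X s \<epsilon> t) \<longleftrightarrow>
     (\<forall>\<tau>. nonexpansive X \<A> \<tau> \<longrightarrow> fdist \<A> (tm_eval \<A> \<tau> s, tm_eval \<A> \<tau> t) \<le> \<epsilon>)"

text \<open>HOL cannot quantify over the carrier type of the algebras inside a formula; it is therefore
  a parameter, independent of the type \<open>'a\<close> of the equations.\<close>

definition entails ::
  "'b itself \<Rightarrow> 'f signature \<Rightarrow> 'v horn set \<Rightarrow>
     ('f, 'a) gequation set \<Rightarrow> ('f, 'a) gequation \<Rightarrow> bool" where
  "entails (_ :: 'b itself) Sig H \<Phi> \<phi> \<longleftrightarrow>
     (\<forall>\<A> :: ('f, 'b) qalgebra.
        quantitative_algebra Sig H \<A> \<longrightarrow> (\<forall>\<psi>\<in>\<Phi>. sat \<A> \<psi>) \<longrightarrow> sat \<A> \<phi>)"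

primrec atom_gequation ::
  "'a frspace \<Rightarrow> ('v \<Rightarrow> ('f, 'a) tm) \<Rightarrow> 'v atom \<Rightarrow> ('f, 'a) gequation" where
  "atom_gequation X \<sigma> (AEq x y) = Eqn X (\<sigma> x) (\<sigma> y)"
| "atom_gequation X \<sigma> (ADist x y \<epsilon>) = QEqn X (\<sigma> x) \<epsilon> (\<sigma> y)"

definition subst_premises ::
  "'a frspace \<Rightarrow> 'a frspace \<Rightarrow> ('a \<Rightarrow> ('f, 'a) tm) \<Rightarrow> ('f, 'a) gequation set" where
  "subst_premises A B \<sigma> =
     {QEqn B (\<sigma> a) (fdist A (a, a')) (\<sigma> a') | a a'. a \<in> pts A \<and> a' \<in> pts A}"

text \<open>In rule \<open>inf\<close>, a family of bounds is given by the set \<open>E\<close> of its values, and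
  \<open>Inf (insert 1 E)\<close> is the infimum of \<open>E\<close> in the complete lattice \<open>[0, 1]\<close>: it agrees with
  \<open>Inf E\<close> for nonempty \<open>E\<close>, and is the top element \<open>1\<close> for empty \<open>E\<close>.\<close>

inductive derives ::
  "'f signature \<Rightarrow> 'v horn set \<Rightarrow> ('f, 'a) gequation set \<Rightarrow> ('f, 'a) gequation \<Rightarrow> bool"
  for Sig :: "'f signature" and H :: "'v horn set"
where
  init: "\<lbrakk>\<Phi> \<subseteq> GEq Sig H; \<phi> \<in> \<Phi>\<rbrakk> \<Longrightarrow> derives Sig H \<Phi> \<phi>"
| cut: "\<lbrakk>\<Phi> \<subseteq> GEq Sig H; \<Phi>' \<subseteq> GEq Sig H; \<And>\<phi>. \<phi> \<in> \<Phi>' \<Longrightarrow> derives Sig H \<Phi> \<phi>;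
      derives Sig H (\<Phi> \<union> \<Phi>') \<psi>\<rbrakk>
    \<Longrightarrow> derives Sig H \<Phi> \<psi>"
| weakening: "\<lbrakk>\<Phi>' \<subseteq> GEq Sig H; derives Sig H \<Phi> \<phi>\<rbrakk> \<Longrightarrow> derives Sig H (\<Phi> \<union> \<Phi>') \<phi>"
| refl: "\<lbrakk>gmet_space H A; s \<in> Terms Sig (pts A)\<rbrakk> \<Longrightarrow> derives Sig H {} (Eqn A s s)"
| sym: "\<lbrakk>gmet_space H A; s \<in> Terms Sig (pts A); t \<in> Terms Sig (pts A)\<rbrakk>
    \<Longrightarrow> derives Sig H {Eqn A s t} (Eqn A t s)"
| trans: "\<lbrakk>gmet_space H A; s \<in> Terms Sig (pts A); t \<in> Terms Sig (pts A); u \<in> Terms Sig (pts A)\<rbrakk>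
    \<Longrightarrow> derives Sig H {Eqn A s t, Eqn A t u} (Eqn A s u)"
| cong: "\<lbrakk>gmet_space H A; Sig f = Some n; length ss = n; length ts = n;
      set ss \<subseteq> Terms Sig (pts A); set ts \<subseteq> Terms Sig (pts A)\<rbrakk>
    \<Longrightarrow> derives Sig H {Eqn A (ss ! i) (ts ! i) | i. i < n} (Eqn A (Op f ss) (Op f ts))"
| subst_eq: "\<lbrakk>gmet_space H A; gmet_space H B; \<sigma> \<in> pts A \<rightarrow> Terms Sig (pts B);
      s \<in> Terms Sig (pts A); t \<in> Terms Sig (pts A)\<rbrakk>
    \<Longrightarrow> derives Sig H (subst_premises A B \<sigma> \<union> {Eqn A s t}) (Eqn B (subst \<sigma> s) (subst \<sigma> t))"
| subst_qeq: "\<lbrakk>gmet_space H A; gmet_space H B; \<sigma> \<in> pts A \<rightarrow> Terms Sig (pts B);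
      s \<in> Terms Sig (pts A); t \<in> Terms Sig (pts A); \<epsilon> \<in> {0..1}\<rbrakk>
    \<Longrightarrow> derives Sig H (subst_premises A B \<sigma> \<union> {QEqn A s \<epsilon> t})
          (QEqn B (subst \<sigma> s) \<epsilon> (subst \<sigma> t))"
| use_vars: "\<lbrakk>gmet_space H A; a \<in> pts A; a' \<in> pts A\<rbrakk>
    \<Longrightarrow> derives Sig H {} (QEqn A (Var a) (fdist A (a, a')) (Var a'))"
| up: "\<lbrakk>gmet_space H A; s \<in> Terms Sig (pts A); t \<in> Terms Sig (pts A);
      \<epsilon> \<in> {0..1}; \<delta> \<in> {0..1}; \<epsilon> \<le> \<delta>\<rbrakk>
    \<Longrightarrow> derives Sig H {QEqn A s \<epsilon> t} (QEqn A s \<delta> t)"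
| one_max: "\<lbrakk>gmet_space H A; s \<in> Terms Sig (pts A); t \<in> Terms Sig (pts A)\<rbrakk>
    \<Longrightarrow> derives Sig H {} (QEqn A s 1 t)"
| inf: "\<lbrakk>gmet_space H A; s \<in> Terms Sig (pts A); t \<in> Terms Sig (pts A); E \<subseteq> {0..1}\<rbrakk>
    \<Longrightarrow> derives Sig H {QEqn A s \<epsilon> t | \<epsilon>. \<epsilon> \<in> E} (QEqn A s (Inf (insert 1 E)) t)"
| compat_left: "\<lbrakk>gmet_space H A; s \<in> Terms Sig (pts A); t \<in> Terms Sig (pts A);
      u \<in> Terms Sig (pts A); \<epsilon> \<in> {0..1}\<rbrakk>
    \<Longrightarrow> derives Sig H {Eqn A s t, QEqn A t \<epsilon> u} (QEqn A s \<epsilon> u)"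
| compat_right: "\<lbrakk>gmet_space H A; s \<in> Terms Sig (pts A); t \<in> Terms Sig (pts A);
      u \<in> Terms Sig (pts A); \<epsilon> \<in> {0..1}\<rbrakk>
    \<Longrightarrow> derives Sig H {Eqn A s t, QEqn A u \<epsilon> s} (QEqn A u \<epsilon> t)"
| horn: "\<lbrakk>gmet_space H A; Horn xs Fs G \<in> H; \<sigma> \<in> set xs \<rightarrow> Terms Sig (pts A)\<rbrakk>
    \<Longrightarrow> derives Sig H (atom_gequation A \<sigma> ` set Fs) (atom_gequation A \<sigma> G)"

end

theory Submission
  imports Defs
begin

text \<open>Soundness is local: in one fixed algebra, each rule carries satisfied premises to a
  satisfied conclusion, so induction on the derivation suffices (\<open>derives_sound\<close>). The
  crux is substitution. Given an interpretation \<tau> of B, the map sending a to the value of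
  \<sigma> a under \<tau> is again an interpretation of A (\<open>nonexpansive_subst\<close>), and
  evaluating a substituted term under \<tau> is evaluating the original term under this map
  (\<open>tm_eval_subst\<close>). The Horn rules hold because the carrier is itself a GMet
  space.\<close>

lemma tm_eval_subst: "tm_eval \<A> \<tau> (subst \<sigma> t) = tm_eval \<A> (\<lambda>a. tm_eval \<A> \<tau> (\<sigma> a)) t"
  by (induction t) (simp_all cong: map_cong)

lemma tm_eval_in_pts:
  assumes "t \<in> Terms Sig A" "quantitative_algebra Sig H \<A>" "\<tau> \<in> A \<rightarrow> pts \<A>"
  shows "tm_eval \<A> \<tau> t \<in> pts \<A>"
  using assms(1)
proof induction
  case (1 a)
  then show ?case using assms(3) by auto
next
  case (2 f ts)
  then have "set (map (tm_eval \<A> \<tau>) ts) \<subseteq> pts \<A>" by auto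
  then show ?case using assms(2) 2(1) unfolding quantitative_algebra_def by simp
qed

lemma fuzzy_space_le_1:
  assumes "fuzzy_space X" "a \<in> pts X" "a' \<in> pts X"
  shows "fdist X (a, a') \<le> 1"
  using PiE_mem[OF assms(1)[unfolded fuzzy_space_def], of "(a, a')"] assms(2,3) by simp

text \<open>The premises in \<open>subst_premises\<close>, evaluated at \<tau>, are exactly the
  required distance bounds. This is what makes the hypothesis on A usable in both substitution
  rules.\<close>

lemma nonexpansive_subst:
  assumes "quantitative_algebra Sig H \<A>" "nonexpansive B \<A> \<tau>"
    and "\<sigma> \<in> pts A \<rightarrow> Terms Sig (pts B)"
    and "\<forall>\<psi>\<in>subst_premises A B \<sigma>. sat \<A> \<psi>"
  shows "nonexpansive A \<A> (\<lambda>a. tm_eval \<A> \<tau> (\<sigma> a))"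
  unfolding nonexpansive_def
proof (intro conjI ballI)
  show "(\<lambda>a. tm_eval \<A> \<tau> (\<sigma> a)) \<in> pts A \<rightarrow> pts \<A>"
    using assms(1-3) by (auto simp: nonexpansive_def intro!: tm_eval_in_pts)
next
  fix a a' assume "a \<in> pts A" "a' \<in> pts A"
  then have "QEqn B (\<sigma> a) (fdist A (a, a')) (\<sigma> a') \<in> subst_premises A B \<sigma>"
    unfolding subst_premises_def by blast
  then have "sat \<A> (QEqn B (\<sigma> a) (fdist A (a, a')) (\<sigma> a'))" using assms(4) by blast
  then show "fdist \<A> (tm_eval \<A> \<tau> (\<sigma> a), tm_eval \<A> \<tau> (\<sigma> a')) \<le> fdist A (a, a')"
    using assms(2) by simp
qed

lemma sat_atom_gequation:
  "sat \<A> (atom_gequation A \<sigma> F) \<longleftrightarrow>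
    (\<forall>\<tau>. nonexpansive A \<A> \<tau> \<longrightarrow> atom_holds \<A> (\<lambda>x. tm_eval \<A> \<tau> (\<sigma> x)) F)"
  by (cases F) simp_all

text \<open>The algebra stays fixed during the induction. For \<open>cut\<close>, it then satisfies
  all of \<Phi>', hence the union from which \<psi> is derived.\<close>

lemma derives_sound:
  assumes "derives Sig H \<Phi> \<phi>" "quantitative_algebra Sig H \<A>" "\<forall>\<psi>\<in>\<Phi>. sat \<A> \<psi>"
  shows "sat \<A> \<phi>"
  using assms(1,3)
proof induction
  case (cut \<Phi> \<Phi>' \<psi>)
  then show ?case by blast
next
  case (cong A f n ss ts)
  have args: "tm_eval \<A> \<tau> (ss ! i) = tm_eval \<A> \<tau> (ts ! i)"
    if "nonexpansive A \<A> \<tau>" "i < n" for \<tau> i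
  proof -
    have "sat \<A> (Eqn A (ss ! i) (ts ! i))" using cong.prems that(2) by blast
    then show ?thesis using that(1) by simp
  qed
  have "map (tm_eval \<A> \<tau>) ss = map (tm_eval \<A> \<tau>) ts" if "nonexpansive A \<A> \<tau>" for \<tau>
    using cong.hyps args[OF that] by (intro nth_equalityI) auto
  then show ?case by simp
next
  case (subst_eq A B \<sigma> s t)
  then show ?case
    using nonexpansive_subst[OF assms(2) _ subst_eq.hyps(3)] by (simp add: tm_eval_subst)
next
  case (subst_qeq A B \<sigma> s t \<epsilon>)
  then show ?case
    using nonexpansive_subst[OF assms(2) _ subst_qeq.hyps(3)] by (simp add: tm_eval_subst)
next
  case (use_vars A a a')
  \<comment> \<open>The conclusion is nonexpansiveness of the interpretation at the pair a,
    a'.\<close>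
  then show ?case by (simp add: nonexpansive_def)
next
  case (up A s t \<epsilon> \<delta>)
  then show ?case by fastforce
next
  case (one_max A s t)
  then show ?case
    using assms(2)
    by (auto simp: nonexpansive_def quantitative_algebra_def gmet_space_def
        intro!: fuzzy_space_le_1 tm_eval_in_pts[OF _ assms(2)])
next
  case (inf A s t E)
  have "fdist \<A> (tm_eval \<A> \<tau> s, tm_eval \<A> \<tau> t) \<le> Inf (insert 1 E)"
    if "nonexpansive A \<A> \<tau>" for \<tau>
  \<comment> \<open>The element 1 keeps the set nonempty even for empty \<open>E\<close>; as a bound
    it holds because distances lie in [0,1].\<close>
  proof (rule cInf_greatest)
    fix \<epsilon> assume "\<epsilon> \<in> insert 1 E"
    then show "fdist \<A> (tm_eval \<A> \<tau> s, tm_eval \<A> \<tau> t) \<le> \<epsilon>"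
    proof
      assume "\<epsilon> = 1"
      then show ?thesis
        using inf.hyps that assms(2)
        by (auto simp: nonexpansive_def quantitative_algebra_def gmet_space_def
            intro!: fuzzy_space_le_1 tm_eval_in_pts[OF _ assms(2)])
    next
      assume "\<epsilon> \<in> E"
      then have "sat \<A> (QEqn A s \<epsilon> t)" using inf.prems by blast
      then show ?thesis using that by simp
    qed
  qed simp
  then show ?case by simp
next
  case (horn A xs Fs G \<sigma>)
  \<comment> \<open>The implication is applied in \<A> to the valuation sending x to the value of
    \<sigma> x under \<tau>, separately for each \<tau>.\<close>
  have "horn_holds \<A> (Horn xs Fs G)"
    using assms(2) horn.hyps(2) by (auto simp: quantitative_algebra_def gmet_space_def)
  moreover have "(\<lambda>x. tm_eval \<A> \<tau> (\<sigma> x)) \<in> set xs \<rightarrow> pts \<A>" if "nonexpansive A \<A> \<tau>" for \<tau>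
    using that horn.hyps(3) assms(2) by (auto simp: nonexpansive_def intro!: tm_eval_in_pts)
  ultimately show ?case
    using horn.prems by (auto simp: sat_atom_gequation)
qed auto

theorem mainTheorem1:
  fixes Sig :: "'f signature"
    and H :: "'v horn set"
    and \<Phi> :: "('f, 'a) gequation set"
    and \<phi> :: "('f, 'a) gequation"
  assumes "\<forall>h\<in>H. wf_horn h"
    and "\<Phi> \<subseteq> GEq Sig H"
    and "\<phi> \<in> GEq Sig H"
    and "derives Sig H \<Phi> \<phi>"
  shows "entails TYPE('b) Sig H \<Phi> \<phi>"
  unfolding entails_def using derives_sound[OF assms(4)] by blast

end
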